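(* Let $a,b,c,d\in\mathbb C\setminus\{0\}$ with $\Re(a+b+c+d)>-1$. Then $$\int_{-\infty}^\infty\frac{1}{\Gamma(2x)\Gamma(-2x)}\prod_{t\in\{a,b,c,d\}}\frac{1}{\Gamma(1+t+x)\,\Gamma(1+t-x)}\,dx$$ $$=-\frac1{2\pi^2}\,\frac{\Gamma(a+b+c+d+1)}{\Gamma(a+b+1)\Gamma(a+c+1)\Gamma(a+d+1)\Gamma(b+c+1)\Gamma(b+d+1)\Gamma(c+d+1)},$$ where $\{a,b,c,d\}$ is a multiset (so the product has one factor for each of the four parameters).
   Context: $\Gamma$ is the gamma function, and $1/\Gamma$ denotes the entire reciprocal gamma function (equal to $0$ at the poles of $\Gamma$). *)

theory Defs
  imports "HOL-Analysis.Analysis" "HOL-Library.Multiset"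
begin

end

theory Submission
  imports Defs "HOL-Probability.Sinc_Integral" "HOL-Real_Asymp.Real_Asymp"
begin

text \<open>
Write \<open>s = a + b + c + d\<close>. By reflection the weight $1/(\Gamma(2x)\Gamma(-2x))$ is
$-2x\sin(2\pi x)/\pi$, and a pair $1/(\Gamma(1+t+x)\Gamma(1+t-x))$ decays like
$|x|^{-2\,\mathrm{Re}\,t-1}$, so the integrand has order $|x|^{-2\,\mathrm{Re}\,s-3}$ and is integrable when
$\mathrm{Re}\,s > -1$.

The evaluation rests on a first-order recurrence. The combination
$(s+1)f_a - (a+b+1)(a+c+1)(a+d+1)f_{a+1}$ of integrands has the form $L(x+1)-L(x)$ with \<open>L\<close> vanishing
at infinity (\<open>wilson_primitive_difference\<close>), hence its integral is 0 (\<open>wilson_integral_contiguous\<close>).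
The Gamma quotient on the right satisfies the same recurrence, so the quotient of the two sides is
1-periodic in \<open>a\<close>.

To see that it is constant in \<open>a\<close>, let \<open>a\<close> run to infinity along \<open>a + N\<close>. After multiplication by
$\Gamma(1+a+N)^2$ the pair of \<open>a + N\<close> stays bounded and tends to 1, so both sides converge to limits
independent of \<open>a\<close> (\<open>wilson_integral_ratio_indep\<close>). As everything is symmetric in the four parameters,
the quotient is one constant for all parameters of nonnegative real part. The constant is read off at
$(0,0,0,-1/2)$, where the integrand is elementary (\<open>wilson_integral_000\<close>), and the recurrence, used
downwards, extends the formula to the whole region $\mathrm{Re}\,s > -1$.
\<close>

section \<open>Pairs of reciprocal Gamma functions\<close>
definition rGamma_pair :: "complex \<Rightarrow> real \<Rightarrow> complex" where
  "rGamma_pair t x = rGamma (1 + t + of_real x) * rGamma (1 + t - of_real x)"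

lemma rGamma_pair_minus: "rGamma_pair t (-x) = rGamma_pair t x"
  by (simp add: rGamma_pair_def mult.commute)

lemma rGamma_pair_abs: "rGamma_pair t \<bar>x\<bar> = rGamma_pair t x"
  by (simp add: abs_if rGamma_pair_minus)

lemma rGamma_pair_translate:
  "(1 + t + of_real x) * rGamma_pair t (x + 1) = (t - of_real x) * rGamma_pair t x"
proof -
  have "(1 + t + of_real x) * rGamma (1 + t + of_real x + 1) = rGamma (1 + t + of_real x)"
    by (rule rGamma_plus1)
  moreover have "(t - of_real x) * rGamma (t - of_real x + 1) = rGamma (t - of_real x)"
    by (rule rGamma_plus1)
  moreover have "rGamma_pair t (x + 1) = rGamma (1 + t + of_real x + 1) * rGamma (t - of_real x)"
    "rGamma_pair t x = rGamma (1 + t + of_real x) * rGamma (t - of_real x + 1)"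
    by (simp_all add: rGamma_pair_def algebra_simps)
  ultimately show ?thesis
    by (simp flip: mult.assoc)
qed

lemma rGamma_pair_shift:
  "rGamma_pair t x = ((t + 1)\<^sup>2 - of_real (x\<^sup>2)) * rGamma_pair (t + 1) x"
proof -
  have "(1 + t + of_real x) * rGamma (1 + t + of_real x + 1) = rGamma (1 + t + of_real x)"
    "(1 + t - of_real x) * rGamma (1 + t - of_real x + 1) = rGamma (1 + t - of_real x)"
    by (rule rGamma_plus1)+
  then have "rGamma_pair t x = ((1 + t + of_real x) * rGamma (1 + t + of_real x + 1))
      * ((1 + t - of_real x) * rGamma (1 + t - of_real x + 1))"
    by (simp add: rGamma_pair_def)
  also have "\<dots> = ((t + 1)\<^sup>2 - of_real (x\<^sup>2)) * rGamma_pair (t + 1) x"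
    by (simp add: rGamma_pair_def power2_eq_square algebra_simps)
  finally show ?thesis .
qed

lemma continuous_on_rGamma_pair [continuous_intros]:
  "continuous_on A f \<Longrightarrow> continuous_on A (\<lambda>x. rGamma_pair t (f x))"
  unfolding rGamma_pair_def
  by (intro continuous_intros continuous_on_compose2[OF continuous_on_rGamma[of UNIV]]) auto

text \<open>
The left-hand norm divided by $|1 + t + x|$ is $1 - (2\,\mathrm{Re}\,t + 1)/x + O(x^{-2})$, while
$((2+x)/(1+x))^p = 1 + p/x + O(x^{-2})$; the hypothesis on \<open>p\<close> orders the two first-order terms.
\<close>
lemma rGamma_pair_ratio_eventually_le:
  assumes "p > - 2 * Re t - 1"
  shows "eventually (\<lambda>x::real. norm (t - of_real x)
           \<le> norm (1 + t + of_real x) * ((2 + x) / (1 + x)) powr p) at_top"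
proof -
  define s where "s = Re t"
  define y where "y = Im t"
  define e where "e = p + 2 * s + 1"
  have e: "e > 0" and p: "p = e - 2 * s - 1" using assms by (auto simp: e_def s_def)
  have "eventually (\<lambda>x::real. sqrt (((s - x)\<^sup>2 + y\<^sup>2) / ((1 + s + x)\<^sup>2 + y\<^sup>2))
           < ((2 + x) / (1 + x)) powr (e - 2 * s - 1)) at_top"
    using e by real_asymp
  moreover have "eventually (\<lambda>x::real. 1 + s + x > 0) at_top"
    by real_asymp
  ultimately show ?thesis
  proof eventually_elim
    case (elim x)
    have pos: "sqrt ((1 + s + x)\<^sup>2 + y\<^sup>2) > 0"
      using elim(2) by (simp add: add_pos_nonneg)
    have "sqrt ((s - x)\<^sup>2 + y\<^sup>2) < ((2 + x) / (1 + x)) powr p * sqrt ((1 + s + x)\<^sup>2 + y\<^sup>2)"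
      using elim(1) pos by (simp add: real_sqrt_divide pos_divide_less_eq p)
    then show ?case
      by (simp add: cmod_def s_def y_def mult.commute)
  qed
qed

text \<open>
The true order of decay is $|x|^{-2\,\mathrm{Re}\,t-1}$. Allowing any larger exponent makes Stirling's
formula unnecessary: with some room in the exponent, the translation identity shows that
$|\mathrm{pair}(x)|\,(1+x)^{-p}$ does not increase under $x \mapsto x + 1$ for large \<open>x\<close>, so its bound on
one compact interval is a bound everywhere.
\<close>
lemma rGamma_pair_decay:
  assumes p: "p > - 2 * Re t - 1"
  obtains C where "C \<ge> 0" "\<And>x. norm (rGamma_pair t x) \<le> C * (1 + \<bar>x\<bar>) powr p"
proof -
  have "eventually (\<lambda>x::real. norm (t - of_real x)
           \<le> norm (1 + t + of_real x) * ((2 + x) / (1 + x)) powr p \<and> 1 + Re t + x > 0 \<and> x \<ge> 0) at_top"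
    by (intro eventually_conj rGamma_pair_ratio_eventually_le[OF p] eventually_ge_at_top) real_asymp
  then obtain X where X: "\<And>x. x \<ge> X \<Longrightarrow> norm (t - of_real x)
           \<le> norm (1 + t + of_real x) * ((2 + x) / (1 + x)) powr p \<and> 1 + Re t + x > 0 \<and> x \<ge> 0"
    unfolding eventually_at_top_linorder by blast
  have X0: "X \<ge> 0" using X[of X] by simp
  define r where "r x = norm (rGamma_pair t x) * (1 + x) powr (- p)" for x
  have step: "r (x + 1) \<le> r x" if x: "x \<ge> X" for x
  proof -
    have x0: "x \<ge> 0" using x X0 by simp
    have pos: "norm (1 + t + of_real x) > 0"
      using X[OF x] by (auto simp: complex_eq_iff)
    have "norm (1 + t + of_real x) * norm (rGamma_pair t (x + 1))
        = norm (t - of_real x) * norm (rGamma_pair t x)"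
  using rGamma_pair_translate[of t x] by (simp flip: norm_mult)
    also have "\<dots> \<le> norm (1 + t + of_real x) * ((2 + x) / (1 + x)) powr p * norm (rGamma_pair t x)"
      using X[OF x] by (intro mult_right_mono) auto
    finally have "norm (rGamma_pair t (x + 1)) \<le> ((2 + x) / (1 + x)) powr p * norm (rGamma_pair t x)"
      using pos by (simp add: mult.assoc)
    then have "r (x + 1) \<le> ((2 + x) / (1 + x)) powr p * norm (rGamma_pair t x) * (2 + x) powr (- p)"
      unfolding r_def by (simp add: mult_right_mono add.commute)
    also have "\<dots> = r x"
      using x0 by (simp add: r_def powr_divide powr_minus field_simps)
    finally show ?thesis .
  qed
  have "continuous_on {0..X + 1} r"
    unfolding r_def by (intro continuous_intros) auto
  then have "bounded (r ` {0..X + 1})"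
    by (intro compact_imp_bounded compact_continuous_image) auto
  then obtain C where C: "\<And>x. x \<in> {0..X + 1} \<Longrightarrow> norm (r x) \<le> C"
    unfolding bounded_iff by blast
  have le: "r x \<le> C" if "x \<in> {0..X + 1 + real n}" for x n
    using that
  proof (induction n arbitrary: x)
    case 0
    then show ?case using C[of x] by auto
  next
    case (Suc n)
    show ?case
    proof (cases "x \<le> X + 1")
      case True
      then show ?thesis using C[of x] Suc.prems by auto
    next
      case False
      then have "r x \<le> r (x - 1)" using step[of "x - 1"] by simp
      also have "\<dots> \<le> C" using Suc.prems False X0 by (intro Suc.IH) auto
      finally show ?thesis .
    qed
  qed
  have "norm (rGamma_pair t x) \<le> C * (1 + \<bar>x\<bar>) powr p" for x
  proof -
    obtain n :: nat where "\<bar>x\<bar> \<le> real n" using real_arch_simple by blast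
    then have "r \<bar>x\<bar> \<le> C" using X0 by (intro le[of _ n]) auto
    then have "r \<bar>x\<bar> * (1 + \<bar>x\<bar>) powr p \<le> C * (1 + \<bar>x\<bar>) powr p"
      by (intro mult_right_mono) auto
    also have "r \<bar>x\<bar> * (1 + \<bar>x\<bar>) powr p = norm (rGamma_pair t x)"
      by (simp add: r_def rGamma_pair_abs powr_minus field_simps)
    finally show ?thesis .
  qed
  moreover have "C \<ge> 0" using C[of 0] X0 norm_ge_zero[of "r 0"] by auto
  ultimately show ?thesis using that by blast
qed

section \<open>Integration over the real line\<close>
lemma integrable_one_plus_abs_powr:
  assumes "p < -1"
  shows "integrable lborel (\<lambda>x::real. (1 + \<bar>x\<bar>) powr p)"
proof -
  have "((\<lambda>x::real. x powr p) has_integral - (1 powr (p + 1)) / (p + 1)) {1..}"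
    by (rule has_integral_powr_to_inf) (use assms in auto)
  then have "(\<lambda>x::real. x powr p) absolutely_integrable_on {1..}"
    by (intro nonnegative_absolutely_integrable_1) (auto simp: integrable_on_def)
  then have int: "integrable lborel (\<lambda>x::real. indicator {1..} x * x powr p)"
    by (simp add: set_integrable_def integrable_completion)
  have "integrable lborel (\<lambda>x::real. indicator {1..} (1 + 1 * x) * (1 + 1 * x) powr p
          + indicator {1..} (1 + (-1) * x) * (1 + (-1) * x) powr p)"
    by (intro Bochner_Integration.integrable_add lborel_integrable_real_affine[OF int]) auto
  then show ?thesis
    by (rule Bochner_Integration.integrable_bound) (auto intro!: AE_I2 simp: indicator_def abs_if)
qed

lemma integral_symmetric_interval_LIMSEQ:
  fixes f :: "real \<Rightarrow> 'a::euclidean_space"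
  assumes "integrable lborel f"
  shows "(\<lambda>n. integral {- real n..real n} f) \<longlonglongrightarrow> integral\<^sup>L lborel f"
proof -
  have "(\<lambda>n. LBINT x:{- real n..real n}. f x) \<longlonglongrightarrow> integral\<^sup>L lborel f"
    unfolding set_lebesgue_integral_def
  proof (rule integral_dominated_convergence[where w = "\<lambda>x. norm (f x)"])
    show "AE x in lborel. (\<lambda>n. indicator {- real n..real n} x *\<^sub>R f x) \<longlonglongrightarrow> f x"
    proof (rule AE_I2, rule tendsto_eventually)
      fix x :: real
      obtain N :: nat where "\<bar>x\<bar> \<le> real N" using real_arch_simple by blast
      then show "eventually (\<lambda>n. indicator {- real n..real n} x *\<^sub>R f x = f x) sequentially"
        by (intro eventually_sequentiallyI[of N]) (auto simp: indicator_def)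
    qed
  qed (use assms in \<open>auto intro!: AE_I2 simp: indicator_def\<close>)
  moreover have "(LBINT x:{- real n..real n}. f x) = integral {- real n..real n} f" for n
    by (rule set_borel_integral_eq_integral(2))
      (auto simp: set_integrable_def intro: integrable_mult_indicator assms)
  ultimately show ?thesis by simp
qed

lemma integral_unit_interval_LIMSEQ_0:
  fixes L :: "real \<Rightarrow> complex" and u :: "nat \<Rightarrow> real"
  assumes cont: "continuous_on UNIV L"
    and lim: "\<And>v. (\<And>n. u n \<le> v n \<and> v n \<le> u n + 1) \<Longrightarrow> (\<lambda>n. L (v n)) \<longlonglongrightarrow> 0"
  shows "(\<lambda>n. integral {u n..u n + 1} L) \<longlonglongrightarrow> 0"
proof -
  have "\<exists>v. u n \<le> v \<and> v \<le> u n + 1 \<and> (\<forall>x\<in>{u n..u n + 1}. norm (L x) \<le> norm (L v))" for n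
    using continuous_attains_sup[of "{u n..u n + 1}" "\<lambda>x. norm (L x)"]
    by (force intro!: continuous_intros continuous_on_subset[OF cont])
  then obtain v where v: "\<And>n. u n \<le> v n" "\<And>n. v n \<le> u n + 1"
      "\<And>n x. x \<in> {u n..u n + 1} \<Longrightarrow> norm (L x) \<le> norm (L (v n))"
    by metis
  have "norm (integral {u n..u n + 1} L) \<le> norm (L (v n))" for n
    using integral_bound[of "u n" "u n + 1" L "norm (L (v n))"] v(3)[of _ n]
    by (auto intro: continuous_on_subset[OF cont])
  moreover have "(\<lambda>n. norm (L (v n))) \<longlonglongrightarrow> 0"
    using lim[of v] v(1,2) by (intro tendsto_norm_zero) auto
  ultimately show ?thesis
    by (rule Lim_null_comparison[OF always_eventually, rule_format])
qed

text \<open>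
Translation invariance does not apply directly, because \<open>L\<close> itself need not be integrable: only the
difference is. Over a symmetric interval the integral telescopes to two integrals of \<open>L\<close> over unit
intervals that move off to infinity.
\<close>
lemma integral_difference_eq_0:
  fixes L :: "real \<Rightarrow> complex"
  assumes cont: "continuous_on UNIV L"
    and top: "(L \<longlongrightarrow> 0) at_top" and bot: "(L \<longlongrightarrow> 0) at_bot"
    and int: "integrable lborel (\<lambda>x. L (x + 1) - L x)"
  shows "(LBINT x. L (x + 1) - L x) = 0"
proof -
  have io: "L integrable_on {a..b}" for a b
    by (intro integrable_continuous_real continuous_on_subset[OF cont]) auto
  have *: "integral {- real n..real n} (\<lambda>x. L (x + 1) - L x)
      = integral {real n..real n + 1} L - integral {- real n..- real n + 1} L" for n
  proof -
    have shift: "((\<lambda>x. L (x + 1)) has_integral integral {- real n + 1..real n + 1} L) {- real n..real n}"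
      using has_integral_affinity'[of L "integral {- real n + 1..real n + 1} L" "- real n + 1" "real n + 1" 1 1]
        integrable_integral[OF io[of "- real n + 1" "real n + 1"]]
      by simp
    have "integral {- real n..real n} (\<lambda>x. L (x + 1) - L x)
        = integral {- real n + 1..real n + 1} L - integral {- real n..real n} L"
      using integral_unique[OF has_integral_diff[OF shift integrable_integral[OF io]]] .
    moreover have "integral {- real n..- real n + 1} L + integral {- real n + 1..real n + 1} L
        = integral {- real n..real n + 1} L"
      by (intro Henstock_Kurzweil_Integration.integral_combine io) auto
    moreover have "integral {- real n..real n} L + integral {real n..real n + 1} L
        = integral {- real n..real n + 1} L"
      by (intro Henstock_Kurzweil_Integration.integral_combine io) auto
    ultimately show ?thesis by algebra
  qed
  have "(\<lambda>n. integral {real n..real n + 1} L) \<longlonglongrightarrow> 0"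
  proof (rule integral_unit_interval_LIMSEQ_0[OF cont])
    fix v assume "\<And>n. real n \<le> v n \<and> v n \<le> real n + 1"
    then have "filterlim v at_top sequentially"
      by (intro filterlim_at_top_mono[OF filterlim_real_sequentially]) auto
    then show "(\<lambda>n. L (v n)) \<longlonglongrightarrow> 0" by (rule filterlim_compose[OF top])
  qed
  moreover have "(\<lambda>n. integral {- real n..- real n + 1} L) \<longlonglongrightarrow> 0"
  proof (rule integral_unit_interval_LIMSEQ_0[OF cont])
    fix v assume v: "\<And>n. - real n \<le> v n \<and> v n \<le> - real n + 1"
    have "filterlim (\<lambda>n. - v n) at_top sequentially"
    proof (rule filterlim_at_top_mono)
      show "filterlim (\<lambda>n. real n - 1) at_top sequentially" by real_asymp
      show "eventually (\<lambda>n. real n - 1 \<le> - v n) sequentially"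
        using v by (auto intro!: always_eventually simp: algebra_simps)
    qed
    then have "filterlim v at_bot sequentially"
      by (simp add: filterlim_uminus_at_top)
    then show "(\<lambda>n. L (v n)) \<longlonglongrightarrow> 0" by (rule filterlim_compose[OF bot])
  qed
  ultimately have "(\<lambda>n. integral {- real n..real n} (\<lambda>x. L (x + 1) - L x)) \<longlonglongrightarrow> 0 - 0"
    unfolding * by (rule tendsto_diff)
  then show ?thesis
    using integral_symmetric_interval_LIMSEQ[OF int] LIMSEQ_unique by force
qed


section \<open>The integrand and its decay\<close>
definition wilson_weight :: "real \<Rightarrow> complex" where
  "wilson_weight x = rGamma (2 * of_real x) * rGamma (- 2 * of_real x)"

lemma wilson_weight_eq: "wilson_weight x = of_real (- 2 * x * sin (2 * pi * x) / pi)"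
  using rGamma_reflection_complex'[of "2 * of_real x"]
  by (simp add: wilson_weight_def mult_ac flip: sin_of_real)

lemma norm_wilson_weight_le: "norm (wilson_weight x) \<le> 1 + \<bar>x\<bar>"
proof -
  have "\<bar>x\<bar> * \<bar>sin (2 * pi * x)\<bar> * 2 \<le> \<bar>x\<bar> * 1 * pi"
    using pi_ge_two by (intro mult_mono) auto
  then have "\<bar>x\<bar> * \<bar>sin (2 * pi * x)\<bar> * 2 / pi \<le> \<bar>x\<bar>"
    by (simp add: field_simps)
  then show ?thesis
    by (simp add: wilson_weight_eq norm_mult norm_divide mult_ac)
qed

lemma continuous_on_wilson_weight [continuous_intros]: "continuous_on A wilson_weight"
  unfolding wilson_weight_eq[abs_def] by (intro continuous_intros) auto

definition rGamma_quad :: "complex \<Rightarrow> complex \<Rightarrow> complex \<Rightarrow> complex \<Rightarrow> real \<Rightarrow> complex" where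
  "rGamma_quad a b c d x = rGamma_pair a x * rGamma_pair b x * rGamma_pair c x * rGamma_pair d x"

lemma continuous_on_rGamma_quad [continuous_intros]: "continuous_on A (rGamma_quad a b c d)"
  unfolding rGamma_quad_def[abs_def] by (intro continuous_intros)

lemma rGamma_quad_decay:
  assumes p: "p > - 2 * Re (a + b + c + d) - 4"
  obtains C where "C \<ge> 0" "\<And>x. norm (rGamma_quad a b c d x) \<le> C * (1 + \<bar>x\<bar>) powr p"
proof -
  \<comment> \<open>The room in the exponent is shared equally among the four factors.\<close>
  define e where "e = (p + 2 * Re (a + b + c + d) + 4) / 4"
  define q where "q t = - 2 * Re t - 1 + e" for t
  have q: "q t > - 2 * Re t - 1" for t using p by (simp add: q_def e_def)
  obtain A where A: "A \<ge> 0" "\<And>x. norm (rGamma_pair a x) \<le> A * (1 + \<bar>x\<bar>) powr q a"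
    using rGamma_pair_decay[OF q] by blast
  obtain B where B: "B \<ge> 0" "\<And>x. norm (rGamma_pair b x) \<le> B * (1 + \<bar>x\<bar>) powr q b"
    using rGamma_pair_decay[OF q] by blast
  obtain C where C: "C \<ge> 0" "\<And>x. norm (rGamma_pair c x) \<le> C * (1 + \<bar>x\<bar>) powr q c"
    using rGamma_pair_decay[OF q] by blast
  obtain D where D: "D \<ge> 0" "\<And>x. norm (rGamma_pair d x) \<le> D * (1 + \<bar>x\<bar>) powr q d"
    using rGamma_pair_decay[OF q] by blast
  have "norm (rGamma_quad a b c d x) \<le> (A * B * C * D) * (1 + \<bar>x\<bar>) powr p" for x
  proof -
    have "norm (rGamma_quad a b c d x) \<le> (A * (1 + \<bar>x\<bar>) powr q a) * (B * (1 + \<bar>x\<bar>) powr q b)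
        * (C * (1 + \<bar>x\<bar>) powr q c) * (D * (1 + \<bar>x\<bar>) powr q d)"
      unfolding rGamma_quad_def norm_mult
      using A(1) B(1) C(1) D(1) by (intro mult_mono A(2) B(2) C(2) D(2)) auto
    also have "\<dots> = (A * B * C * D) * (1 + \<bar>x\<bar>) powr (q a + q b + q c + q d)"
      by (simp add: powr_add mult_ac)
    also have "q a + q b + q c + q d = p"
      by (simp add: q_def e_def field_simps)
    finally show ?thesis .
  qed
  moreover have "A * B * C * D \<ge> 0" using A(1) B(1) C(1) D(1) by simp
  ultimately show ?thesis using that by blast
qed

definition wilson_integrand :: "complex \<Rightarrow> complex \<Rightarrow> complex \<Rightarrow> complex \<Rightarrow> real \<Rightarrow> complex" where
  "wilson_integrand a b c d x = wilson_weight x * rGamma_quad a b c d x"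

lemma integrable_wilson_integrand:
  assumes "Re (a + b + c + d) > -1"
  shows "integrable lborel (wilson_integrand a b c d)"
proof -
  \<comment> \<open>The midpoint between the exponent of the integrand, $-2\,\mathrm{Re}(a+b+c+d)-3$, and $-1$.\<close>
  define q where "q = - Re (a + b + c + d) - 2"
  have q: "q < -1" "q - 1 > - 2 * Re (a + b + c + d) - 4"
    using assms by (auto simp: q_def)
  obtain C where C: "C \<ge> 0" "\<And>x. norm (rGamma_quad a b c d x) \<le> C * (1 + \<bar>x\<bar>) powr (q - 1)"
    using rGamma_quad_decay[OF q(2)] by blast
  show ?thesis
  proof (rule Bochner_Integration.integrable_bound)
    show "integrable lborel (\<lambda>x::real. C * (1 + \<bar>x\<bar>) powr q)"
      by (intro integrable_mult_right integrable_one_plus_abs_powr q)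
    show "wilson_integrand a b c d \<in> borel_measurable lborel"
      unfolding wilson_integrand_def[abs_def]
      by (simp, intro borel_measurable_continuous_onI continuous_intros)
    show "AE x in lborel. norm (wilson_integrand a b c d x) \<le> norm (C * (1 + \<bar>x\<bar>) powr q)"
    proof (rule AE_I2)
      fix x :: real
      have "norm (wilson_integrand a b c d x) \<le> (1 + \<bar>x\<bar>) * (C * (1 + \<bar>x\<bar>) powr (q - 1))"
        unfolding wilson_integrand_def norm_mult
        by (intro mult_mono norm_wilson_weight_le C) auto
      also have "\<dots> = C * (1 + \<bar>x\<bar>) powr q"
        by (simp add: powr_diff)
      finally show "norm (wilson_integrand a b c d x) \<le> norm (C * (1 + \<bar>x\<bar>) powr q)"
        using C(1) by simp
    qed
  qed
qed

definition wilson_integral :: "complex \<Rightarrow> complex \<Rightarrow> complex \<Rightarrow> complex \<Rightarrow> complex" where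
  "wilson_integral a b c d = (LBINT x. wilson_integrand a b c d x)"

lemma wilson_integral_permute:
  "wilson_integral b a c d = wilson_integral a b c d"
  "wilson_integral c b a d = wilson_integral a b c d"
  "wilson_integral d b c a = wilson_integral a b c d"
  by (simp_all add: wilson_integral_def wilson_integrand_def rGamma_quad_def mult_ac)

section \<open>The contiguous relation\<close>

text \<open>
A discrete antiderivative for the contiguous relation: up to the 1-periodic sine factor it is the
telescoping certificate of a well-poised bilateral hypergeometric series, and it is symmetric under
$x \mapsto 1 - x$. Its four linear factors cancel one factor of each pair when \<open>x\<close> is increased by 1.
\<close>
definition wilson_primitive :: "complex \<Rightarrow> complex \<Rightarrow> complex \<Rightarrow> complex \<Rightarrow> real \<Rightarrow> complex" where
  "wilson_primitive a b c d x = - of_real (sin (2 * pi * x) / pi) *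
     ((a + 1 + of_real x) * (b + of_real x) * (c + of_real x) * (d + of_real x)
      * rGamma_quad (a + 1) b c d x)"

text \<open>
Put $A = a + 1$. By the translation identity for pairs, the shift by 1 amounts to replacing
$(A+x)(b+x)(c+x)(d+x)$ by $(A-x)(b-x)(c-x)(d-x)$ in front of the same sine and the same four pairs. The
difference of the two products is odd in \<open>x\<close> and equals
$2x\,[(A+b+c+d)(A^2-x^2) - (A+b)(A+c)(A+d)]$. The factor $A^2-x^2$ lowers \<open>a + 1\<close> to \<open>a\<close> in the first
term, and $x$ times the sine is the weight up to a constant.
\<close>
lemma wilson_primitive_difference:
  "wilson_primitive a b c d (x + 1) - wilson_primitive a b c d x
     = (a + b + c + d + 1) * wilson_integrand a b c d x
       - (a + b + 1) * (a + c + 1) * (a + d + 1) * wilson_integrand (a + 1) b c d x"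
proof -
  define X where "X = complex_of_real x"
  define S where "S = complex_of_real (sin (2 * pi * x) / pi)"
  define Q where "Q = rGamma_quad (a + 1) b c d x"
  have "sin (2 * pi * (x + 1)) = sin (2 * pi * x)"
    by (simp add: distrib_left sin_add)
  then have "wilson_primitive a b c d (x + 1) = - S *
     (((1 + (a + 1) + X) * rGamma_pair (a + 1) (x + 1)) * ((1 + b + X) * rGamma_pair b (x + 1))
      * ((1 + c + X) * rGamma_pair c (x + 1)) * ((1 + d + X) * rGamma_pair d (x + 1)))"
    by (simp add: wilson_primitive_def rGamma_quad_def S_def X_def add_ac mult_ac)
  also have "\<dots> = - S * ((a + 1 - X) * (b - X) * (c - X) * (d - X) * Q)"
    unfolding X_def rGamma_pair_translate Q_def rGamma_quad_def by (simp add: mult_ac)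
  finally have shifted: "wilson_primitive a b c d (x + 1)
      = - S * ((a + 1 - X) * (b - X) * (c - X) * (d - X) * Q)" .
  have unshifted: "wilson_primitive a b c d x = - S * ((a + 1 + X) * (b + X) * (c + X) * (d + X) * Q)"
    by (simp add: wilson_primitive_def S_def X_def Q_def)
  have W: "wilson_weight x = - 2 * X * S"
    by (simp add: wilson_weight_eq X_def S_def)
  have R: "rGamma_quad a b c d x = ((a + 1)\<^sup>2 - X\<^sup>2) * Q"
    using rGamma_pair_shift[of a x] by (simp add: rGamma_quad_def Q_def X_def mult_ac)
  have poly: "(A - X) * (b - X) * (c - X) * (d - X) - (A + X) * (b + X) * (c + X) * (d + X)
      = 2 * X * ((A + b + c + d) * (A\<^sup>2 - X\<^sup>2) - (A + b) * (A + c) * (A + d))" for A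
    by (simp add: power2_eq_square algebra_simps)
  have "wilson_primitive a b c d (x + 1) - wilson_primitive a b c d x
      = - S * Q * ((a + 1 - X) * (b - X) * (c - X) * (d - X)
          - (a + 1 + X) * (b + X) * (c + X) * (d + X))"
    unfolding shifted unshifted by (simp add: right_diff_distrib mult_ac)
  also have "\<dots> = (a + 1 + b + c + d) * (- 2 * X * S * (((a + 1)\<^sup>2 - X\<^sup>2) * Q))
      - (a + 1 + b) * (a + 1 + c) * (a + 1 + d) * (- 2 * X * S * Q)"
    unfolding poly by (simp add: right_diff_distrib mult_ac)
  also have "\<dots> = (a + b + c + d + 1) * wilson_integrand a b c d x
       - (a + b + 1) * (a + c + 1) * (a + d + 1) * wilson_integrand (a + 1) b c d x"
    unfolding wilson_integrand_def W R Q_def[symmetric] by (simp add: add_ac)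
  finally show ?thesis .
qed

lemma wilson_primitive_tendsto_0:
  assumes "Re (a + b + c + d) > -1"
  shows "(wilson_primitive a b c d \<longlongrightarrow> 0) at_top" "(wilson_primitive a b c d \<longlongrightarrow> 0) at_bot"
proof -
  \<comment> \<open>The midpoint between the true exponent of the function, $-2\,\mathrm{Re}(a+b+c+d)-2$, and 0.\<close>
  define q where "q = - Re (a + b + c + d) - 1"
  have q: "q < 0" "q - 4 > - 2 * Re (a + 1 + b + c + d) - 4"
    using assms by (auto simp: q_def)
  obtain C where C: "C \<ge> 0" "\<And>x. norm (rGamma_quad (a + 1) b c d x) \<le> C * (1 + \<bar>x\<bar>) powr (q - 4)"
    using rGamma_quad_decay[OF q(2)] by blast
  have lin: "norm (t + of_real x) \<le> (1 + norm t) * (1 + \<bar>x\<bar>)" for t :: complex and x :: real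
  proof -
    have "norm (t + of_real x) \<le> norm t + \<bar>x\<bar>"
      using norm_triangle_ineq[of t "of_real x"] by simp
    also have "\<dots> \<le> (1 + norm t) * (1 + \<bar>x\<bar>)"
      by (simp add: algebra_simps)
    finally show ?thesis .
  qed
  define K where "K = (1 + norm (a + 1)) * (1 + norm b) * (1 + norm c) * (1 + norm d) * C"
  have bound: "norm (wilson_primitive a b c d x) \<le> K * (1 + \<bar>x\<bar>) powr q" for x
  proof -
    have "\<bar>sin (2 * pi * x)\<bar> \<le> pi"
      using abs_sin_le_one[of "2 * pi * x"] pi_ge_two by linarith
    then have "norm (wilson_primitive a b c d x) \<le> 1 * (((1 + norm (a + 1)) * (1 + \<bar>x\<bar>))
        * ((1 + norm b) * (1 + \<bar>x\<bar>)) * ((1 + norm c) * (1 + \<bar>x\<bar>)) * ((1 + norm d) * (1 + \<bar>x\<bar>))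
        * (C * (1 + \<bar>x\<bar>) powr (q - 4)))"
      unfolding wilson_primitive_def norm_mult
      by (intro mult_mono lin C) (auto simp: norm_divide)
    also have "\<dots> = K * ((1 + \<bar>x\<bar>) ^ 4 * (1 + \<bar>x\<bar>) powr (q - 4))"
      by (simp add: K_def power4_eq_xxxx mult_ac)
    also have "(1 + \<bar>x\<bar>) ^ 4 * (1 + \<bar>x\<bar>) powr (q - 4) = (1 + \<bar>x\<bar>) powr q"
      by (simp add: powr_diff)
    finally show ?thesis .
  qed
  have lim: "(wilson_primitive a b c d \<longlongrightarrow> 0) F" if "((\<lambda>x. (1 + \<bar>x\<bar>) powr q) \<longlongrightarrow> 0) F" for F
    using bound by (intro Lim_null_comparison[OF always_eventually tendsto_mult_right_zero[OF that, of K]]) auto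
  show "(wilson_primitive a b c d \<longlongrightarrow> 0) at_top"
    by (rule lim) (use q(1) in real_asymp)
  show "(wilson_primitive a b c d \<longlongrightarrow> 0) at_bot"
    by (rule lim) (use q(1) in real_asymp)
qed

text \<open>
The same recurrence as for the Gamma quotient on the other side of the evaluation. It holds on the
whole domain of convergence because the discrete antiderivative has order
$|x|^{-2\,\mathrm{Re}(a+b+c+d)-2}$, up to an arbitrarily small loss in the exponent, and so tends to 0.
\<close>
lemma wilson_integral_contiguous:
  assumes "Re (a + b + c + d) > -1"
  shows "(a + b + c + d + 1) * wilson_integral a b c d
     = (a + b + 1) * (a + c + 1) * (a + d + 1) * wilson_integral (a + 1) b c d"
proof -
  have int: "integrable lborel (wilson_integrand a b c d)"
    "integrable lborel (wilson_integrand (a + 1) b c d)"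
    by (rule integrable_wilson_integrand; use assms in simp)+
  have "(LBINT x. wilson_primitive a b c d (x + 1) - wilson_primitive a b c d x) = 0"
  proof (rule integral_difference_eq_0)
    show "continuous_on UNIV (wilson_primitive a b c d)"
      unfolding wilson_primitive_def[abs_def] by (intro continuous_intros) auto
    show "integrable lborel (\<lambda>x. wilson_primitive a b c d (x + 1) - wilson_primitive a b c d x)"
      unfolding wilson_primitive_difference
      by (intro Bochner_Integration.integrable_diff integrable_mult_right int)
  qed (use wilson_primitive_tendsto_0[OF assms] in auto)
  then show ?thesis
    unfolding wilson_primitive_difference wilson_integral_def using int by simp
qed

section \<open>One parameter tending to infinity\<close>

text \<open>
The factor $(t-x)/(1+t+x)$ of the translation identity has absolute value at most 1, since
$|1+t+x|^2 - |t-x|^2 = (1 + 2\,\mathrm{Re}\,t)(1+2x)$. Hence the supremum over the whole line is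
already attained on the fundamental interval $[-1/2, 1/2]$.
\<close>
lemma norm_rGamma_pair_translate_le:
  assumes "Re t \<ge> 0" "x \<ge> - 1 / 2"
  shows "norm (rGamma_pair t (x + 1)) \<le> norm (rGamma_pair t x)"
proof -
  have "(1 + Re t + x)\<^sup>2 - (Re t - x)\<^sup>2 = (1 + 2 * Re t) * (1 + 2 * x)"
    by (simp add: power2_eq_square algebra_simps)
  also have "\<dots> \<ge> 0"
    using assms by simp
  finally have le: "norm (t - of_real x) \<le> norm (1 + t + of_real x)"
    by (simp add: cmod_def)
  have "1 + Re t + x > 0"
    using assms by simp
  then have "norm (1 + t + of_real x) > 0"
    by (auto simp: complex_eq_iff)
  moreover have "norm (1 + t + of_real x) * norm (rGamma_pair t (x + 1))
      \<le> norm (1 + t + of_real x) * norm (rGamma_pair t x)"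
    using rGamma_pair_translate[of t x] mult_right_mono[OF le, of "norm (rGamma_pair t x)"]
    by (simp flip: norm_mult)
  ultimately show ?thesis
    by simp
qed

lemma norm_rGamma_pair_le_fundamental:
  assumes "Re t \<ge> 0"
  obtains y where "\<bar>y\<bar> \<le> 1 / 2" "norm (rGamma_pair t x) \<le> norm (rGamma_pair t y)"
proof -
  have *: "\<exists>y. \<bar>y\<bar> \<le> 1 / 2 \<and> norm (rGamma_pair t x) \<le> norm (rGamma_pair t y)"
    if "0 \<le> x" "x \<le> 1 / 2 + real n" for x n
    using that
  proof (induction n arbitrary: x)
    case 0
    then show ?case by (intro exI[of _ x]) auto
  next
    case (Suc n)
    show ?case
    proof (cases "x \<le> 1 / 2")
      case True
      then show ?thesis using Suc.prems by (intro exI[of _ x]) auto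
    next
      case False
      have le: "norm (rGamma_pair t x) \<le> norm (rGamma_pair t (x - 1))"
        using norm_rGamma_pair_translate_le[OF assms, of "x - 1"] False by simp
      show ?thesis
      proof (cases "x \<le> 1")
        case True
        then show ?thesis using le False by (intro exI[of _ "x - 1"]) auto
      next
        case False
        then show ?thesis using Suc.IH[of "x - 1"] Suc.prems le by fastforce
      qed
    qed
  qed
  obtain n :: nat where "\<bar>x\<bar> \<le> real n" using real_arch_simple by blast
  then show ?thesis
    using *[of "\<bar>x\<bar>" n] that by (auto simp: rGamma_pair_abs)
qed

lemma not_nonpos_Int_if_Re_pos: "Re z > 0 \<Longrightarrow> z \<notin> \<int>\<^sub>\<le>\<^sub>0"
  by (auto elim!: nonpos_Ints_cases)

text \<open>
The domination needed to let one parameter tend to infinity. As translates away from the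
fundamental interval are no larger, only $|x| \le 1/2$ matters. There, passing from \<open>N\<close> to \<open>N + 1\<close> multiplies the function by
$z^2/(z^2-x^2)$ with $z = a+N+1$, which is at most $m^2/(m^2-1/4)$ for $m = N + 1$ in absolute value.
The product of these numbers over all \<open>m\<close> converges.
\<close>
lemma normalized_rGamma_pair_bounded:
  assumes a: "Re a \<ge> 0"
  obtains C where
    "\<And>N x. norm ((Gamma (1 + a + of_nat N))\<^sup>2 * rGamma_pair (a + of_nat N) x) \<le> C"
proof -
  define g where "g N x = (Gamma (1 + a + of_nat N))\<^sup>2 * rGamma_pair (a + of_nat N) x" for N :: nat and x
  have "bounded (g 0 ` {-1/2..1/2})"
    unfolding g_def by (intro compact_imp_bounded compact_continuous_image continuous_intros) auto
  then obtain C where C': "\<forall>x\<in>{-1/2..1/2}. norm (g 0 x) \<le> C"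
    unfolding bounded_iff by blast
  have C: "norm (g 0 x) \<le> C" if "\<bar>x\<bar> \<le> 1 / 2" for x
    using C' abs_le_D1[OF that] abs_le_D2[OF that] by auto
  have C0: "C \<ge> 0"
    using C[of 0] norm_ge_zero[of "g 0 0"] by linarith
  have step: "norm (g (Suc N) x) * ((real N + 1)\<^sup>2 - 1 / 4) \<le> (real N + 1)\<^sup>2 * norm (g N x)"
    if x: "\<bar>x\<bar> \<le> 1 / 2" for N x
  proof -
    define z where "z = a + of_nat N"
    define r where "r = norm (z + 1)"
    define m where "m = real N + 1"
    have "m \<le> Re (z + 1)" using a by (simp add: z_def m_def)
    also have "\<dots> \<le> r" unfolding r_def by (rule complex_Re_le_cmod)
    finally have mr: "m \<le> r" .
    have m1: "m \<ge> 1" by (simp add: m_def)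
    have x2: "x\<^sup>2 \<le> 1 / 4"
      using power_mono[OF x, of 2] by (simp add: power2_eq_square)
    have G: "Gamma (1 + z + 1) = (1 + z) * Gamma (1 + z)"
      using a by (intro Gamma_plus1 not_nonpos_Int_if_Re_pos) (simp add: z_def)
    have "((z + 1)\<^sup>2 - of_real (x\<^sup>2)) * g (Suc N) x = (z + 1)\<^sup>2 * g N x"
    proof -
      have "g (Suc N) x = (Gamma (1 + z + 1))\<^sup>2 * rGamma_pair (z + 1) x"
        by (simp add: g_def z_def add_ac)
      moreover have "g N x = (Gamma (1 + z))\<^sup>2 * rGamma_pair z x"
        by (simp add: g_def z_def add_ac)
      ultimately show ?thesis
        unfolding G rGamma_pair_shift[of z x] by (simp add: power_mult_distrib add.commute mult_ac)
    qed
    then have "norm ((z + 1)\<^sup>2 - of_real (x\<^sup>2)) * norm (g (Suc N) x) = r\<^sup>2 * norm (g N x)"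
      by (metis norm_mult norm_power r_def)
    moreover have "r\<^sup>2 - 1 / 4 \<le> norm ((z + 1)\<^sup>2 - of_real (x\<^sup>2))"
      using norm_triangle_ineq2[of "(z + 1)\<^sup>2" "of_real (x\<^sup>2)"] x2
      by (simp add: norm_power r_def)
    ultimately have *: "(r\<^sup>2 - 1 / 4) * norm (g (Suc N) x) \<le> r\<^sup>2 * norm (g N x)"
      by (metis mult_right_mono norm_ge_zero)
    have m2: "m\<^sup>2 \<ge> 1" using m1 by simp
    have r2: "r\<^sup>2 \<ge> m\<^sup>2" using mr m1 by (intro power_mono) auto
    have "norm (g (Suc N) x) \<le> r\<^sup>2 / (r\<^sup>2 - 1 / 4) * norm (g N x)"
      using * m2 r2 by (simp add: field_simps)
    also have "\<dots> \<le> m\<^sup>2 / (m\<^sup>2 - 1 / 4) * norm (g N x)"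
      using m2 r2 by (intro mult_right_mono) (auto simp: field_simps)
    finally have "norm (g (Suc N) x) \<le> m\<^sup>2 * norm (g N x) / (m\<^sup>2 - 1 / 4)"
      by simp
    moreover have "m\<^sup>2 - 1 / 4 > 0"
      using m2 by simp
    ultimately show ?thesis
      unfolding m_def[symmetric] by (simp only: pos_le_divide_eq)
  qed
  \<comment> \<open>$2 - 1/(N+1)$ majorizes the product of $m^2/(m^2-1/4)$ over $m \le N$ and stays below 2.\<close>
  have bound: "norm (g N x) \<le> C * (2 - 1 / (real N + 1))" if x: "\<bar>x\<bar> \<le> 1 / 2" for N x
  proof (induction N)
    case 0
    then show ?case using C[OF x] by simp
  next
    case (Suc N)
    define m where "m = real N + 1"
    have m: "m \<ge> 1" by (simp add: m_def)
    then have m2: "m\<^sup>2 - 1 / 4 > 0"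
      using one_le_power[of m 2] by linarith
    have "norm (g (Suc N) x) * (m\<^sup>2 - 1 / 4) \<le> m\<^sup>2 * norm (g N x)"
      using step[OF x, of N] by (simp add: m_def)
    also have "\<dots> \<le> m\<^sup>2 * (C * (2 - 1 / m))"
      using Suc.IH by (intro mult_left_mono) (auto simp: m_def)
    also have "\<dots> = C * (m\<^sup>2 * (2 - 1 / m))"
      by simp
    also have "\<dots> \<le> C * ((2 - 1 / (m + 1)) * (m\<^sup>2 - 1 / 4))"
    proof (rule mult_left_mono[OF _ C0])
      have "(2 - 1 / (m + 1)) * (m\<^sup>2 - 1 / 4) - m\<^sup>2 * (2 - 1 / m) = (2 * m - 1) / (4 * (m + 1))"
        using m by (simp add: divide_simps) (simp add: power2_eq_square algebra_simps)
      also have "\<dots> \<ge> 0"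
        using m by simp
      finally show "m\<^sup>2 * (2 - 1 / m) \<le> (2 - 1 / (m + 1)) * (m\<^sup>2 - 1 / 4)"
        by simp
    qed
    finally have "norm (g (Suc N) x) \<le> C * (2 - 1 / (m + 1))"
      using m2 by (simp flip: mult.assoc)
    then show ?case by (simp add: m_def add_ac)
  qed
  have "norm (g N x) \<le> 2 * C" for N x
  proof -
    obtain y where y: "\<bar>y\<bar> \<le> 1 / 2"
      "norm (rGamma_pair (a + of_nat N) x) \<le> norm (rGamma_pair (a + of_nat N) y)"
      using norm_rGamma_pair_le_fundamental[of "a + of_nat N" x] a by auto
    then have "norm (g N x) \<le> norm (g N y)"
      by (simp add: g_def norm_mult mult_left_mono)
    also have "\<dots> \<le> C * (2 - 1 / (real N + 1))"
      by (rule bound[OF y(1)])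
    also have "\<dots> \<le> C * 2"
      using C0 by (intro mult_left_mono) auto
    finally show ?thesis by simp
  qed
  then show ?thesis using that unfolding g_def by blast
qed

text \<open>
$n!\,n^z$, the leading behaviour of $\Gamma(z+n+1)$.
\<close>
definition Gamma_scale :: "complex \<Rightarrow> nat \<Rightarrow> complex" where
  "Gamma_scale z n = fact n * exp (z * of_real (ln (real n)))"

lemma Gamma_scale_nonzero [simp]: "Gamma_scale z n \<noteq> 0"
  by (simp add: Gamma_scale_def)

lemma Gamma_scale_mult: "Gamma_scale (z + w) n * fact n = Gamma_scale z n * Gamma_scale w n"
  by (simp add: Gamma_scale_def exp_add distrib_right)

text \<open>
Stated for the reciprocal function so that it holds for every complex \<open>z\<close>. When $\mathrm{Re}\,z > 0$ it is
the Gauss product. The recurrence of the Gamma function transports it one unit to the left at a time.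
\<close>
lemma rGamma_scale_LIMSEQ:
  "(\<lambda>n. rGamma (z + of_nat n + 1) * Gamma_scale z n) \<longlonglongrightarrow> 1"
proof -
  have pos: "(\<lambda>n. rGamma (z + of_nat n + 1) * Gamma_scale z n) \<longlonglongrightarrow> 1" if "Re z > 0" for z
  proof -
    have z: "z \<notin> \<int>\<^sub>\<le>\<^sub>0" by (rule not_nonpos_Int_if_Re_pos[OF that])
    have nz: "rGamma z \<noteq> 0" using z by (simp add: rGamma_eq_zero_iff)
    have "rGamma z / rGamma_series z n = rGamma (z + of_nat n + 1) * Gamma_scale z n" for n
    proof -
      have "pochhammer z (n + 1) \<noteq> 0" using z pochhammer_eq_0_imp_nonpos_Int by blast
      then show ?thesis
        by (subst pochhammer_rGamma[of z "n + 1"])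
          (simp add: rGamma_series_def Gamma_scale_def add_ac)
    qed
    moreover have "(\<lambda>n. rGamma z / rGamma_series z n) \<longlonglongrightarrow> rGamma z / rGamma z"
      by (intro tendsto_intros nz)
    ultimately show ?thesis using nz by simp
  qed
  have down: "(\<lambda>n. rGamma (z + of_nat n + 1) * Gamma_scale z n) \<longlonglongrightarrow> 1"
    if lim: "(\<lambda>n. rGamma (z + 1 + of_nat n + 1) * Gamma_scale (z + 1) n) \<longlonglongrightarrow> 1" for z
  proof -
    have "(\<lambda>n. (z + 1) / of_nat n + 1) \<longlonglongrightarrow> 0 + 1"
      by (intro tendsto_add tendsto_const lim_const_over_n)
    then have "(\<lambda>n. rGamma (z + 1 + of_nat n + 1) * Gamma_scale (z + 1) n * ((z + 1) / of_nat n + 1)) \<longlonglongrightarrow> 1 * (0 + 1)"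
      by (intro tendsto_mult lim)
    moreover have "eventually (\<lambda>n. rGamma (z + 1 + of_nat n + 1) * Gamma_scale (z + 1) n * ((z + 1) / of_nat n + 1)
        = rGamma (z + of_nat n + 1) * Gamma_scale z n) sequentially"
      using eventually_gt_at_top[of 0]
    proof eventually_elim
      case (elim n)
      have "(z + of_nat n + 1) * rGamma (z + of_nat n + 1 + 1) = rGamma (z + of_nat n + 1)"
        by (rule rGamma_plus1)
      moreover have "Gamma_scale (z + 1) n = Gamma_scale z n * of_nat n"
        using elim by (simp add: Gamma_scale_def distrib_right exp_add exp_of_real)
      ultimately show ?case
        using elim by (simp add: field_simps)
    qed
    ultimately show ?thesis
      by (simp add: tendsto_cong)
  qed
  have "(\<lambda>n. rGamma (z + of_nat n + 1) * Gamma_scale z n) \<longlonglongrightarrow> 1" if "Re z + real k > 0" for z k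
    using that
  proof (induction k arbitrary: z)
    case 0
    show ?case by (rule pos) (use 0 in simp)
  next
    case (Suc k)
    show ?case by (rule down, rule Suc.IH) (use Suc.prems in simp)
  qed
  moreover have "Re z + real k > 0" if "- Re z < real k" for k
    using that by simp
  moreover obtain k where "- Re z < real k"
    using reals_Archimedean2 by blast
  ultimately show ?thesis by blast
qed

lemma Gamma_scale_LIMSEQ:
  "(\<lambda>n. Gamma (z + of_nat n + 1) / Gamma_scale z n) \<longlonglongrightarrow> 1"
  using tendsto_inverse[OF rGamma_scale_LIMSEQ[of z]]
  by (simp add: rGamma_inverse_Gamma field_simps)

lemma normalized_rGamma_pair_LIMSEQ:
  "(\<lambda>N. (Gamma (1 + a + of_nat N))\<^sup>2 * rGamma_pair (a + of_nat N) x) \<longlonglongrightarrow> 1"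
proof -
  have "(\<lambda>N. (Gamma (a + of_nat N + 1) / Gamma_scale a N)\<^sup>2
      * (rGamma ((a + of_real x) + of_nat N + 1) * Gamma_scale (a + of_real x) N)
      * (rGamma ((a - of_real x) + of_nat N + 1) * Gamma_scale (a - of_real x) N)) \<longlonglongrightarrow> 1\<^sup>2 * 1 * 1"
    by (intro tendsto_mult tendsto_power rGamma_scale_LIMSEQ Gamma_scale_LIMSEQ)
  moreover have "Gamma_scale (a + of_real x) N * Gamma_scale (a - of_real x) N = (Gamma_scale a N)\<^sup>2" for N
    using Gamma_scale_mult[of "a + of_real x" "a - of_real x" N] Gamma_scale_mult[of a a N]
    by (simp add: power2_eq_square)
  then have "(Gamma (a + of_nat N + 1) / Gamma_scale a N)\<^sup>2
      * (rGamma ((a + of_real x) + of_nat N + 1) * Gamma_scale (a + of_real x) N)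
      * (rGamma ((a - of_real x) + of_nat N + 1) * Gamma_scale (a - of_real x) N)
      = (Gamma (1 + a + of_nat N))\<^sup>2 * rGamma_pair (a + of_nat N) x" for N
    by (simp add: rGamma_pair_def field_simps power2_eq_square)
  ultimately show ?thesis by simp
qed

section \<open>Comparison with the Gamma quotient\<close>
definition wilson_value :: "complex \<Rightarrow> complex \<Rightarrow> complex \<Rightarrow> complex \<Rightarrow> complex" where
  "wilson_value a b c d = Gamma (a + b + c + d + 1) *
     (rGamma (a + b + 1) * rGamma (a + c + 1) * rGamma (a + d + 1) *
      rGamma (b + c + 1) * rGamma (b + d + 1) * rGamma (c + d + 1))"

lemma wilson_value_permute:
  "wilson_value b a c d = wilson_value a b c d"
  "wilson_value c b a d = wilson_value a b c d"
  "wilson_value d b c a = wilson_value a b c d"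
  by (simp_all add: wilson_value_def add_ac mult_ac)

lemma wilson_value_contiguous:
  assumes "Re (a + b + c + d) > -1"
  shows "(a + b + c + d + 1) * wilson_value a b c d
     = (a + b + 1) * (a + c + 1) * (a + d + 1) * wilson_value (a + 1) b c d"
proof -
  have G: "Gamma (a + b + c + d + 1 + 1) = (a + b + c + d + 1) * Gamma (a + b + c + d + 1)"
    by (intro Gamma_plus1 not_nonpos_Int_if_Re_pos) (use assms in simp)
  have "wilson_value (a + 1) b c d = Gamma (a + b + c + d + 1 + 1) *
     (rGamma (a + b + 1 + 1) * rGamma (a + c + 1 + 1) * rGamma (a + d + 1 + 1) *
      rGamma (b + c + 1) * rGamma (b + d + 1) * rGamma (c + d + 1))"
    by (simp add: wilson_value_def add_ac)
  moreover have "wilson_value a b c d = Gamma (a + b + c + d + 1) *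
     (((a + b + 1) * rGamma (a + b + 1 + 1)) * ((a + c + 1) * rGamma (a + c + 1 + 1))
      * ((a + d + 1) * rGamma (a + d + 1 + 1)) *
      rGamma (b + c + 1) * rGamma (b + d + 1) * rGamma (c + d + 1))"
    unfolding rGamma_plus1 wilson_value_def by (simp only: mult.assoc)
  ultimately show ?thesis
    unfolding G by (simp only: mult_ac)
qed

lemma wilson_value_nonzero:
  assumes "Re a \<ge> 0" "Re b \<ge> 0" "Re c \<ge> 0" "Re d \<ge> 0"
  shows "wilson_value a b c d \<noteq> 0"
proof -
  have "Gamma z \<noteq> 0" "rGamma z \<noteq> 0" if "Re z > 0" for z :: complex
    using not_nonpos_Int_if_Re_pos[OF that] by (simp_all add: Gamma_eq_zero_iff rGamma_eq_zero_iff)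
  then show ?thesis
    using assms by (simp add: wilson_value_def add_nonneg_pos)
qed

text \<open>
Both sides of the evaluation satisfy the same first-order recurrence in \<open>a\<close>, so their quotient is
1-periodic in \<open>a\<close>.
\<close>
lemma wilson_integral_ratio_translate:
  assumes "Re a \<ge> 0" "Re b \<ge> 0" "Re c \<ge> 0" "Re d \<ge> 0"
  shows "wilson_integral (a + of_nat N) b c d / wilson_value (a + of_nat N) b c d
    = wilson_integral a b c d / wilson_value a b c d"
proof (induction N)
  case (Suc N)
  define z where "z = a + of_nat N"
  have z: "Re z \<ge> 0" using assms(1) by (simp add: z_def)
  have nz: "wilson_value z b c d \<noteq> 0" "wilson_value (z + 1) b c d \<noteq> 0"
    by (intro wilson_value_nonzero; use z assms in simp)+
  define k where "k = (z + b + 1) * (z + c + 1) * (z + d + 1)"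
  have "z + t + 1 \<noteq> 0" if "Re t \<ge> 0" for t
    using z that by (auto simp: complex_eq_iff)
  then have k: "k \<noteq> 0"
    using assms by (simp add: k_def)
  have s: "Re (z + b + c + d) > - 1" "z + b + c + d + 1 \<noteq> 0"
    using z assms by (auto simp: complex_eq_iff)
  have "wilson_integral z b c d / wilson_value z b c d
      = (z + b + c + d + 1) * wilson_integral z b c d / ((z + b + c + d + 1) * wilson_value z b c d)"
    using s(2) by simp
  also have "\<dots> = wilson_integral (z + 1) b c d / wilson_value (z + 1) b c d"
    unfolding wilson_integral_contiguous[OF s(1)] wilson_value_contiguous[OF s(1)]
    using k unfolding k_def[symmetric] by simp
  finally show ?case
    using Suc.IH by (simp add: z_def add_ac)
qed simp

text \<open>
The scales cancel because $s + 2a = (a+b)+(a+c)+(a+d)$ for $s = a+b+c+d$, and three factorials appear on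
either side.
\<close>
lemma wilson_value_normalized_LIMSEQ:
  "(\<lambda>N. (Gamma (1 + a + of_nat N))\<^sup>2 * wilson_value (a + of_nat N) b c d)
     \<longlonglongrightarrow> rGamma (b + c + 1) * rGamma (b + d + 1) * rGamma (c + d + 1)"
proof -
  define R where "R = rGamma (b + c + 1) * rGamma (b + d + 1) * rGamma (c + d + 1)"
  define s where "s = a + b + c + d"
  have "(\<lambda>N. (Gamma (a + of_nat N + 1) / Gamma_scale a N)\<^sup>2
      * (Gamma (s + of_nat N + 1) / Gamma_scale s N)
      * (rGamma ((a + b) + of_nat N + 1) * Gamma_scale (a + b) N)
      * (rGamma ((a + c) + of_nat N + 1) * Gamma_scale (a + c) N)
      * (rGamma ((a + d) + of_nat N + 1) * Gamma_scale (a + d) N) * R) \<longlonglongrightarrow> 1\<^sup>2 * 1 * 1 * 1 * 1 * R"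
    by (intro tendsto_mult tendsto_power rGamma_scale_LIMSEQ Gamma_scale_LIMSEQ tendsto_const)
  moreover have "(Gamma (a + of_nat N + 1) / Gamma_scale a N)\<^sup>2
      * (Gamma (s + of_nat N + 1) / Gamma_scale s N)
      * (rGamma ((a + b) + of_nat N + 1) * Gamma_scale (a + b) N)
      * (rGamma ((a + c) + of_nat N + 1) * Gamma_scale (a + c) N)
      * (rGamma ((a + d) + of_nat N + 1) * Gamma_scale (a + d) N) * R
     = (Gamma (1 + a + of_nat N))\<^sup>2 * wilson_value (a + of_nat N) b c d" for N
  proof -
    have E: "Gamma_scale (a + b) N * Gamma_scale (a + c) N * Gamma_scale (a + d) N
        = (Gamma_scale a N)\<^sup>2 * Gamma_scale s N"
      by (simp add: Gamma_scale_def s_def power2_eq_square exp_add distrib_right)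
    have "wilson_value (a + of_nat N) b c d = Gamma (s + of_nat N + 1) *
      (rGamma ((a + b) + of_nat N + 1) * rGamma ((a + c) + of_nat N + 1)
        * rGamma ((a + d) + of_nat N + 1) * R)"
      by (simp add: wilson_value_def R_def s_def add_ac mult_ac)
    moreover have "(G / e)\<^sup>2 * (H / f) * (x * u) * (y * v) * (z * w) * R
        = G\<^sup>2 * (H * (x * y * z * R))"
      if "u * v * w = e\<^sup>2 * f" "e \<noteq> 0" "f \<noteq> 0" for G H e f u v w x y z :: complex
    proof -
      have "(G / e)\<^sup>2 * (H / f) * (x * u) * (y * v) * (z * w) * R
          = G\<^sup>2 * (H * (x * y * z * R)) * ((u * v * w) / (e\<^sup>2 * f))"
        by (simp add: power_divide)
      then show ?thesis using that by simp
    qed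
    ultimately show ?thesis
      using E by (simp add: add_ac)
  qed
  ultimately show ?thesis
    by (simp add: R_def mult_ac)
qed

text \<open>
Dominated convergence: the normalized pair of \<open>a + N\<close> is bounded uniformly in \<open>N\<close> and \<open>x\<close> and tends to 1,
and the three remaining pairs already decay fast enough to be integrable against the weight.
\<close>
lemma wilson_integral_normalized_LIMSEQ:
  assumes a: "Re a \<ge> 0" and "Re b \<ge> 0" "Re c \<ge> 0" "Re d \<ge> 0"
  shows "(\<lambda>N. (Gamma (1 + a + of_nat N))\<^sup>2 * wilson_integral (a + of_nat N) b c d)
     \<longlonglongrightarrow> (LBINT x. wilson_weight x * (rGamma_pair b x * rGamma_pair c x * rGamma_pair d x))"
proof -
  define T where "T x = rGamma_pair b x * rGamma_pair c x * rGamma_pair d x" for x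
  \<comment> \<open>Three factors of order $-5/6$ and the linear weight give the integrable order $-3/2$.\<close>
  have q: "- 5 / 6 > - 2 * Re t - 1" if "Re t \<ge> 0" for t
    using that by simp
  obtain B where B: "B \<ge> 0" "\<And>x. norm (rGamma_pair b x) \<le> B * (1 + \<bar>x\<bar>) powr (- 5 / 6)"
    using rGamma_pair_decay[OF q] assms by blast
  obtain C where C: "C \<ge> 0" "\<And>x. norm (rGamma_pair c x) \<le> C * (1 + \<bar>x\<bar>) powr (- 5 / 6)"
    using rGamma_pair_decay[OF q] assms by blast
  obtain D where D: "D \<ge> 0" "\<And>x. norm (rGamma_pair d x) \<le> D * (1 + \<bar>x\<bar>) powr (- 5 / 6)"
    using rGamma_pair_decay[OF q] assms by blast
  define f where "f x = B * C * D * (1 + \<bar>x\<bar>) powr (- 3 / 2)" for x :: real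
  have f: "integrable lborel f"
    unfolding f_def by (intro integrable_mult_right integrable_one_plus_abs_powr) simp
  have WT: "norm (wilson_weight x * T x) \<le> f x" for x
  proof -
    have "norm (wilson_weight x * T x) \<le> (1 + \<bar>x\<bar>) * ((B * (1 + \<bar>x\<bar>) powr (- 5 / 6))
        * (C * (1 + \<bar>x\<bar>) powr (- 5 / 6)) * (D * (1 + \<bar>x\<bar>) powr (- 5 / 6)))"
      unfolding norm_mult T_def using B(1) C(1)
      by (intro mult_mono norm_wilson_weight_le B(2) C(2) D(2)) auto
    also have "\<dots> = B * C * D * ((1 + \<bar>x\<bar>) powr 1 * (1 + \<bar>x\<bar>) powr (- 5 / 6)
         * (1 + \<bar>x\<bar>) powr (- 5 / 6) * (1 + \<bar>x\<bar>) powr (- 5 / 6))"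
      by simp
    also have "\<dots> = f x"
      unfolding f_def powr_add[symmetric] by simp
    finally show ?thesis .
  qed
  obtain M where M: "\<And>N x. norm ((Gamma (1 + a + of_nat N))\<^sup>2 * rGamma_pair (a + of_nat N) x) \<le> M"
    using normalized_rGamma_pair_bounded[OF a] by blast
  have cont: "continuous_on UNIV T"
    unfolding T_def by (intro continuous_intros)
  have "(\<lambda>N. LBINT x. (Gamma (1 + a + of_nat N))\<^sup>2 * rGamma_pair (a + of_nat N) x * (wilson_weight x * T x))
      \<longlonglongrightarrow> (LBINT x. wilson_weight x * T x)"
  proof (rule integral_dominated_convergence[where w = "\<lambda>x. M * f x"])
    show "integrable lborel (\<lambda>x. M * f x)"
      using f by simp
    show "AE x in lborel. (\<lambda>N. (Gamma (1 + a + of_nat N))\<^sup>2 * rGamma_pair (a + of_nat N) x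
        * (wilson_weight x * T x)) \<longlonglongrightarrow> wilson_weight x * T x"
      using tendsto_mult[OF normalized_rGamma_pair_LIMSEQ tendsto_const] by (intro AE_I2) force
    show "AE x in lborel. norm ((Gamma (1 + a + of_nat N))\<^sup>2 * rGamma_pair (a + of_nat N) x
        * (wilson_weight x * T x)) \<le> M * f x" for N
    proof (rule AE_I2)
      fix x
      have "0 \<le> M" using norm_ge_zero M order_trans by blast
      then show "norm ((Gamma (1 + a + of_nat N))\<^sup>2 * rGamma_pair (a + of_nat N) x
        * (wilson_weight x * T x)) \<le> M * f x"
        unfolding norm_mult[of "(Gamma (1 + a + of_nat N))\<^sup>2 * rGamma_pair (a + of_nat N) x"]
        by (intro mult_mono M WT) auto
    qed
  qed (simp, intro borel_measurable_continuous_onI continuous_intros cont)+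
  moreover have "(LBINT x. (Gamma (1 + a + of_nat N))\<^sup>2 * rGamma_pair (a + of_nat N) x * (wilson_weight x * T x))
      = (Gamma (1 + a + of_nat N))\<^sup>2 * wilson_integral (a + of_nat N) b c d" for N
  proof -
    have "(Gamma (1 + a + of_nat N))\<^sup>2 * rGamma_pair (a + of_nat N) x * (wilson_weight x * T x)
        = (Gamma (1 + a + of_nat N))\<^sup>2 * wilson_integrand (a + of_nat N) b c d x" for x
      by (simp add: wilson_integrand_def rGamma_quad_def T_def)
    then have "(LBINT x. (Gamma (1 + a + of_nat N))\<^sup>2 * rGamma_pair (a + of_nat N) x * (wilson_weight x * T x))
        = (LBINT x. (Gamma (1 + a + of_nat N))\<^sup>2 * wilson_integrand (a + of_nat N) b c d x)"
      by presburger
    then show ?thesis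
      unfolding wilson_integral_def by simp
  qed
  ultimately show ?thesis
    unfolding T_def by simp
qed

text \<open>
The quotient is unchanged by \<open>a \<mapsto> a + N\<close>, and as \<open>N\<close> tends to infinity its numerator and denominator,
normalized in the same way, have limits in which \<open>a\<close> no longer occurs. This replaces the usual
argument that an entire periodic function of small growth is constant.
\<close>
lemma wilson_integral_ratio_indep:
  assumes "Re a \<ge> 0" "Re a' \<ge> 0" "Re b \<ge> 0" "Re c \<ge> 0" "Re d \<ge> 0"
  shows "wilson_integral a b c d / wilson_value a b c d
    = wilson_integral a' b c d / wilson_value a' b c d"
proof -
  define J where "J = (LBINT x. wilson_weight x * (rGamma_pair b x * rGamma_pair c x * rGamma_pair d x))"
  define R where "R = rGamma (b + c + 1) * rGamma (b + d + 1) * rGamma (c + d + 1)"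
  have "R \<noteq> 0"
    using assms by (simp add: R_def rGamma_eq_zero_iff not_nonpos_Int_if_Re_pos add_nonneg_pos)
  have "wilson_integral a b c d / wilson_value a b c d = J / R" if a: "Re a \<ge> 0" for a
  proof -
    define \<rho> where "\<rho> = wilson_integral a b c d / wilson_value a b c d"
    have "wilson_integral (a + of_nat N) b c d = \<rho> * wilson_value (a + of_nat N) b c d" for N
    proof -
      have "wilson_value (a + of_nat N) b c d \<noteq> 0"
        by (rule wilson_value_nonzero) (use a assms in auto)
      then show ?thesis
        using wilson_integral_ratio_translate[OF a assms(3-5), of N] by (simp add: \<rho>_def field_simps)
    qed
    moreover have "(\<lambda>N. \<rho> * ((Gamma (1 + a + of_nat N))\<^sup>2 * wilson_value (a + of_nat N) b c d)) \<longlonglongrightarrow> \<rho> * R"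
      unfolding R_def by (intro tendsto_mult tendsto_const wilson_value_normalized_LIMSEQ)
    ultimately have "(\<lambda>N. (Gamma (1 + a + of_nat N))\<^sup>2 * wilson_integral (a + of_nat N) b c d) \<longlonglongrightarrow> \<rho> * R"
      by (simp add: mult_ac)
    then have "\<rho> * R = J"
      using wilson_integral_normalized_LIMSEQ[OF a assms(3-5)] LIMSEQ_unique unfolding J_def by blast
    then show ?thesis
      using \<open>R \<noteq> 0\<close> by (simp add: \<rho>_def field_simps)
  qed
  then show ?thesis using assms by simp
qed

section \<open>An explicit evaluation\<close>
lemma rGamma_pair_0: "x \<noteq> 0 \<Longrightarrow> rGamma_pair 0 x = of_real (sin (pi * x) / (pi * x))"
proof -
  assume x: "x \<noteq> 0"
  have "of_real x * rGamma_pair 0 x = rGamma (of_real x) * rGamma (1 - of_real x)"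
    using rGamma_plus1[of "complex_of_real x"] by (simp add: rGamma_pair_def add.commute mult_ac)
  also have "\<dots> = of_real (sin (pi * x) / pi)"
    by (simp add: rGamma_reflection_complex flip: sin_of_real)
  finally show ?thesis
    using x by (simp add: field_simps)
qed

lemma rGamma_pair_minus_half: "rGamma_pair (- 1 / 2) x = of_real (cos (pi * x) / pi)"
proof -
  have "rGamma_pair (- 1 / 2) x = rGamma (of_real (1 / 2 + x)) * rGamma (1 - of_real (1 / 2 + x))"
    by (simp add: rGamma_pair_def)
  also have "\<dots> = of_real (sin (pi * (1 / 2 + x)) / pi)"
    by (simp only: rGamma_reflection_complex of_real_divide of_real_mult flip: sin_of_real)
  also have "sin (pi * (1 / 2 + x)) = cos (pi * x)"
    by (simp add: distrib_left sin_add)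
  finally show ?thesis .
qed

text \<open>
For these parameters the Gamma functions collapse by reflection to trigonometric functions. The value
$-1/2$ supplies the cosine that turns the cube of the sine into $\sin^2(\pi x)\sin(2\pi x)/2$.
\<close>
lemma wilson_integrand_000:
  assumes "x \<noteq> 0"
  shows "wilson_integrand 0 0 0 (- 1 / 2) x
    = of_real (- ((sin (2 * pi * x))\<^sup>2 * (sin (pi * x))\<^sup>2 / x\<^sup>2) / pi ^ 5)"
proof -
  have "wilson_integrand 0 0 0 (- 1 / 2) x
      = of_real ((- 2 * x * sin (2 * pi * x) / pi) * (sin (pi * x) / (pi * x)) ^ 3 * (cos (pi * x) / pi))"
    unfolding wilson_integrand_def wilson_weight_eq rGamma_quad_def
      rGamma_pair_0[OF assms] rGamma_pair_minus_half
    by (simp only: of_real_mult power3_eq_cube mult_ac)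
  also have "(- 2 * x * sin (2 * pi * x) / pi) * (sin (pi * x) / (pi * x)) ^ 3 * (cos (pi * x) / pi)
      = - (sin (2 * pi * x) * (2 * sin (pi * x) * cos (pi * x)) * (sin (pi * x))\<^sup>2 / x\<^sup>2) / pi ^ 5"
    using assms by (simp add: field_simps power2_eq_square power3_eq_cube eval_nat_numeral)
  also have "2 * sin (pi * x) * cos (pi * x) = sin (2 * pi * x)"
    using sin_double[of "pi * x"] by (simp add: mult_ac)
  finally show ?thesis
    by (simp add: power2_eq_square)
qed

lemma DERIV_Si_scaled:
  assumes "x \<noteq> 0" "k \<noteq> 0"
  shows "((\<lambda>x. Si (k * x)) has_real_derivative sin (k * x) / x) (at x)"
  using DERIV_chain2[OF DERIV_Si[of "k * x"] DERIV_cmult_Id[of k x]] assms by simp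

text \<open>
$\int \sin^2(2\pi x)\sin^2(\pi x)/x^2\,dx = \pi^2/2$: expanding the numerator into cosines and integrating
by parts reduces it to the Dirichlet integral, in the form $\mathrm{Si}(x) \to \pi/2$.
\<close>
lemma wilson_integral_000: "wilson_integral 0 0 0 (- 1 / 2) = - of_real (1 / (2 * pi ^ 3))"
proof -
  \<comment> \<open>$\sin^2(2\pi x)\sin^2(\pi x)/x$, the boundary term of the integration by parts, continuous also at 0.\<close>
  define h where "h x = (sin (2 * pi * x))\<^sup>2 * sin (pi * x) * pi * sinc (pi * x)" for x
  define A where "A x = 2 * pi * (1 / 2 * Si (4 * pi * x) + 1 / 8 * Si (2 * pi * x)
      - 3 / 8 * Si (6 * pi * x)) - h x" for x
  have contA: "continuous_on S A" for S
    unfolding A_def h_def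
    by (intro continuous_intros continuous_on_compose2[OF continuous_at_imp_continuous_on[of UNIV Si]])
      (auto simp: isCont_Si)
  have deriv: "(A has_real_derivative (sin (2 * pi * x))\<^sup>2 * (sin (pi * x))\<^sup>2 / x\<^sup>2) (at x)"
    if x: "x \<noteq> 0" for x
  proof -
    \<comment> \<open>The numerator as a cosine polynomial.\<close>
    define N where "N x = 1 / 4 - 1 / 4 * cos (4 * pi * x) - 1 / 8 * cos (2 * pi * x)
        + 1 / 8 * cos (6 * pi * x)" for x
    have N: "(sin (2 * pi * x))\<^sup>2 * (sin (pi * x))\<^sup>2 = N x" for x
    proof -
      define u where "u = cos (2 * pi * x)"
      have "cos (2 * pi * x) = 1 - 2 * (sin (pi * x))\<^sup>2"
        using cos_double_sin[of "pi * x"] by (simp add: mult_ac)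
      then have s1: "(sin (pi * x))\<^sup>2 = (1 - u) / 2"
        by (simp add: u_def)
      have s2: "(sin (2 * pi * x))\<^sup>2 = 1 - u\<^sup>2"
        by (simp add: u_def sin_squared_eq)
      have c2: "cos (4 * pi * x) = 2 * u\<^sup>2 - 1"
        using cos_double_cos[of "2 * pi * x"] by (simp add: u_def mult_ac)
      have c3: "cos (6 * pi * x) = 4 * u ^ 3 - 3 * u"
        using cos_treble_cos[of "2 * pi * x"] by (simp add: u_def mult_ac)
      show ?thesis
        unfolding N_def s1 s2 c2 c3 u_def[symmetric]
        by (simp add: power2_eq_square power3_eq_cube field_simps)
    qed
    define D where "D = 2 * pi * (1 / 2 * sin (4 * pi * x) + 1 / 8 * sin (2 * pi * x)
        - 3 / 8 * sin (6 * pi * x))"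
    have N': "(N has_real_derivative D) (at x)"
      unfolding N_def D_def by (auto intro!: derivative_eq_intros simp: algebra_simps)
    have "((\<lambda>x. 2 * pi * (1 / 2 * Si (4 * pi * x) + 1 / 8 * Si (2 * pi * x)
        - 3 / 8 * Si (6 * pi * x)) - N x / x) has_real_derivative
        2 * pi * (1 / 2 * (sin (4 * pi * x) / x) + 1 / 8 * (sin (2 * pi * x) / x)
        - 3 / 8 * (sin (6 * pi * x) / x)) - (D * x - N x * 1) / (x * x)) (at x)"
      by (intro DERIV_diff DERIV_add DERIV_cmult DERIV_divide DERIV_Si_scaled N' DERIV_ident x) auto
    also have "2 * pi * (1 / 2 * (sin (4 * pi * x) / x) + 1 / 8 * (sin (2 * pi * x) / x)
        - 3 / 8 * (sin (6 * pi * x) / x)) = D / x"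
      unfolding D_def using x by (simp add: field_simps)
    also have "D / x - (D * x - N x * 1) / (x * x) = N x / x\<^sup>2"
      using x by (simp add: field_simps power2_eq_square)
    finally have "((\<lambda>x. 2 * pi * (1 / 2 * Si (4 * pi * x) + 1 / 8 * Si (2 * pi * x)
        - 3 / 8 * Si (6 * pi * x)) - N x / x) has_real_derivative N x / x\<^sup>2) (at x)" .
    moreover have ev: "eventually (\<lambda>y. 2 * pi * (1 / 2 * Si (4 * pi * y) + 1 / 8 * Si (2 * pi * y)
      - 3 / 8 * Si (6 * pi * y)) - N y / y = A y) (nhds x)"
    proof -
      have "eventually (\<lambda>y. y \<noteq> 0) (nhds x)"
        using x by (intro t1_space_nhds) auto
      then show ?thesis
        by eventually_elim (simp add: A_def h_def flip: N, simp add: power2_eq_square)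
    qed
    ultimately show ?thesis
      unfolding N using DERIV_cong_ev[OF refl ev refl] by simp
  qed
  have "((wilson_integrand 0 0 0 (- 1 / 2)) has_integral
      (of_real (- A (real n) / pi ^ 5) - of_real (- A (- real n) / pi ^ 5))) {- real n..real n}" for n
  proof (rule fundamental_theorem_of_calculus_strong[where S = "{0}"])
    show "continuous_on {- real n..real n} (\<lambda>x. complex_of_real (- A x / pi ^ 5))"
      by (intro continuous_intros contA) auto
    show "((\<lambda>x. complex_of_real (- A x / pi ^ 5)) has_vector_derivative
        wilson_integrand 0 0 0 (- 1 / 2) x) (at x)" if "x \<in> {- real n..real n} - {0}" for x
    proof -
      have x: "x \<noteq> 0" using that by auto
      have "((\<lambda>x. - A x / pi ^ 5) has_real_derivative
          - ((sin (2 * pi * x))\<^sup>2 * (sin (pi * x))\<^sup>2 / x\<^sup>2) / pi ^ 5) (at x)"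
        by (intro DERIV_cdivide DERIV_minus deriv x)
      then show ?thesis
        unfolding wilson_integrand_000[OF x]
        by (intro has_vector_derivative_of_real) (simp add: has_real_derivative_iff_has_vector_derivative)
    qed
  qed auto
  moreover have "of_real (- A (real n) / pi ^ 5) - of_real (- A (- real n) / pi ^ 5)
    = complex_of_real (- 4 / pi ^ 4 * (1 / 2 * Si (4 * pi * real n) + 1 / 8 * Si (2 * pi * real n)
      - 3 / 8 * Si (6 * pi * real n)))" for n
  proof -
    \<comment> \<open>The boundary term vanishes at the integers, so only the values of Si remain.\<close>
    have "sin (pi * real n) = 0" by (simp add: mult.commute)
    then have "h (real n) = 0" "h (- real n) = 0" by (simp_all add: h_def)
    then have "A (real n) = 2 * pi * (1 / 2 * Si (4 * pi * real n) + 1 / 8 * Si (2 * pi * real n)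
      - 3 / 8 * Si (6 * pi * real n))" "A (- real n) = - A (real n)"
      by (simp_all add: A_def Si_neg algebra_simps)
    then have "- A (real n) / pi ^ 5 - (- A (- real n) / pi ^ 5) =
       - 4 / pi ^ 4 * (1 / 2 * Si (4 * pi * real n) + 1 / 8 * Si (2 * pi * real n)
      - 3 / 8 * Si (6 * pi * real n))"
      by (simp add: field_simps eval_nat_numeral)
    then show ?thesis
      by (simp only: flip: of_real_diff)
  qed
  ultimately have I: "integral {- real n..real n} (wilson_integrand 0 0 0 (- 1 / 2))
    = complex_of_real (- 4 / pi ^ 4 * (1 / 2 * Si (4 * pi * real n) + 1 / 8 * Si (2 * pi * real n)
      - 3 / 8 * Si (6 * pi * real n)))" for n
    by (simp only: integral_unique)
  have Si: "(\<lambda>n. Si (k * pi * real n)) \<longlonglongrightarrow> pi / 2" if "k > 0" for k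
    by (rule filterlim_compose[OF Si_at_top]) (use that in real_asymp)
  have "(\<lambda>n. integral {- real n..real n} (wilson_integrand 0 0 0 (- 1 / 2))) \<longlonglongrightarrow>
     complex_of_real (- 4 / pi ^ 4 * (1 / 2 * (pi / 2) + 1 / 8 * (pi / 2) - 3 / 8 * (pi / 2)))"
    unfolding I by (intro tendsto_intros Si) auto
  moreover have "(\<lambda>n. integral {- real n..real n} (wilson_integrand 0 0 0 (- 1 / 2)))
      \<longlonglongrightarrow> wilson_integral 0 0 0 (- 1 / 2)"
    unfolding wilson_integral_def
    by (intro integral_symmetric_interval_LIMSEQ integrable_wilson_integrand) simp
  ultimately have "wilson_integral 0 0 0 (- 1 / 2)
      = complex_of_real (- 4 / pi ^ 4 * (1 / 2 * (pi / 2) + 1 / 8 * (pi / 2) - 3 / 8 * (pi / 2)))"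
    by (rule LIMSEQ_unique[rotated])
  also have "- 4 / pi ^ 4 * (1 / 2 * (pi / 2) + 1 / 8 * (pi / 2) - 3 / 8 * (pi / 2)) = - (1 / (2 * pi ^ 3))"
    by (simp add: field_simps eval_nat_numeral)
  finally show ?thesis by simp
qed

section \<open>All parameters\<close>
definition wilson_formula :: "complex \<Rightarrow> complex \<Rightarrow> complex \<Rightarrow> complex \<Rightarrow> bool" where
  "wilson_formula a b c d \<longleftrightarrow>
     wilson_integral a b c d = - (1 / (2 * of_real pi ^ 2)) * wilson_value a b c d"

lemma wilson_formula_swap:
  assumes "wilson_formula a b c d"
  shows wilson_formula_swap12: "wilson_formula b a c d"
    and wilson_formula_swap13: "wilson_formula c b a d"
    and wilson_formula_swap14: "wilson_formula d b c a"
  using assms wilson_integral_permute[where a = a and b = b and c = c and d = d]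
    wilson_value_permute[where a = a and b = b and c = c and d = d]
  by (simp_all add: wilson_formula_def)

text \<open>
The step that reaches parameters of negative real part: the recurrence is solved for the integral with
the smaller parameter, whose coefficient $a+b+c+d+1$ has positive real part on the domain of convergence.
\<close>
lemma wilson_formula_descend:
  assumes "Re (a + b + c + d) > -1" "wilson_formula (a + 1) b c d"
  shows "wilson_formula a b c d"
proof -
  have "(a + b + c + d + 1) * wilson_integral a b c d
      = (a + b + c + d + 1) * (- (1 / (2 * of_real pi ^ 2)) * wilson_value a b c d)"
    using assms(2) wilson_integral_contiguous[OF assms(1)] wilson_value_contiguous[OF assms(1)]
    by (simp add: wilson_formula_def)
  moreover have "a + b + c + d + 1 \<noteq> 0"
    using assms(1) by (auto simp: complex_eq_iff)
  ultimately show ?thesis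
    unfolding wilson_formula_def by (rule mult_left_cancel[THEN iffD1, rotated])
qed

lemma wilson_formula_descend_nat:
  assumes "Re (a + b + c + d) > -1" "wilson_formula (a + of_nat n) b c d"
  shows "wilson_formula a b c d"
  using assms
proof (induction n arbitrary: a)
  case (Suc n)
  have "wilson_formula (a + 1) b c d"
    by (rule Suc.IH) (use Suc.prems in \<open>simp_all add: add_ac\<close>)
  then show ?case
    by (rule wilson_formula_descend[OF Suc.prems(1)])
qed simp

text \<open>
Since the quotient of integral and value does not see \<open>a\<close>, one correct quadruple yields all others that
differ from it only in \<open>a\<close>.
\<close>
lemma wilson_formula_exchange:
  assumes "Re a \<ge> 0" "Re a' \<ge> 0" "Re b \<ge> 0" "Re c \<ge> 0" "Re d \<ge> 0"
    and "wilson_formula a b c d"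
  shows "wilson_formula a' b c d"
proof -
  have "wilson_value a b c d \<noteq> 0" "wilson_value a' b c d \<noteq> 0"
    by (intro wilson_value_nonzero assms)+
  moreover define \<kappa> :: complex where "\<kappa> = - (1 / (2 * of_real pi ^ 2))"
  ultimately show ?thesis
    using wilson_integral_ratio_indep[OF assms(1-5)] assms(6)
    unfolding wilson_formula_def \<kappa>_def[symmetric] by (simp add: divide_eq_eq)
qed

text \<open>
The explicit evaluation at $(0,0,0,-1/2)$, moved by the recurrence to the nearest point at which all
real parts are nonnegative.
\<close>
lemma wilson_formula_base: "wilson_formula 0 0 0 (1 / 2)"
proof -
  have "wilson_integral 0 0 0 (1 / 2) = wilson_integral (1 / 2) 0 0 0"
    by (rule wilson_integral_permute(3))
  also have "\<dots> = 4 * wilson_integral (- 1 / 2) 0 0 0"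
    using wilson_integral_contiguous[of "- 1 / 2" 0 0 0] by simp
  also have "wilson_integral (- 1 / 2) 0 0 0 = wilson_integral 0 0 0 (- 1 / 2)"
    by (rule wilson_integral_permute(3))
  also have "4 * wilson_integral 0 0 0 (- 1 / 2) = - of_real (2 / pi ^ 3)"
    unfolding wilson_integral_000 by simp
  finally have I: "wilson_integral 0 0 0 (1 / 2) = - of_real (2 / pi ^ 3)" .
  have G: "Gamma (3 / 2 :: complex) = of_real (sqrt pi) / 2"
    using Gamma_plus1[of "1 / 2 :: complex"] not_nonpos_Int_if_Re_pos[of "1 / 2"]
    by (simp add: Gamma_one_half_complex)
  have "of_real (sqrt pi) * of_real (sqrt pi) = complex_of_real pi"
    by (simp flip: of_real_mult)
  moreover have "wilson_value 0 0 0 (1 / 2) = inverse (Gamma (3 / 2) * Gamma (3 / 2))"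
    using not_nonpos_Int_if_Re_pos[of "3 / 2"]
    by (simp add: wilson_value_def rGamma_inverse_Gamma Gamma_eq_zero_iff)
  then have "wilson_value 0 0 0 (1 / 2) = 4 / (of_real (sqrt pi) * of_real (sqrt pi))"
    unfolding G by (simp add: field_simps)
  ultimately have "wilson_value 0 0 0 (1 / 2) = 4 / of_real pi"
    by simp
  then show ?thesis
    unfolding wilson_formula_def I by (simp add: power2_eq_square power3_eq_cube)
qed

lemma wilson_formula_nonneg:
  assumes "Re a \<ge> 0" "Re b \<ge> 0" "Re c \<ge> 0" "Re d \<ge> 0"
  shows "wilson_formula a b c d"
proof -
  note exchange = wilson_formula_exchange[rotated 5]
  have "wilson_formula (1 / 2) 0 0 0"
    by (rule wilson_formula_swap14[OF wilson_formula_base])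
  then have "wilson_formula d 0 0 0"
    by (rule exchange) (use assms in auto)
  then have "wilson_formula 0 0 0 d"
    by (rule wilson_formula_swap14)
  then have "wilson_formula c 0 0 d"
    by (rule exchange) (use assms in auto)
  then have "wilson_formula 0 0 c d"
    by (rule wilson_formula_swap13)
  then have "wilson_formula b 0 c d"
    by (rule exchange) (use assms in auto)
  then have "wilson_formula 0 b c d"
    by (rule wilson_formula_swap12)
  then show ?thesis
    by (rule exchange) (use assms in auto)
qed

lemma wilson_formula_all:
  assumes "Re (a + b + c + d) > -1"
  shows "wilson_formula a b c d"
proof -
  obtain n :: nat where n: "norm a + norm b + norm c + norm d \<le> real n"
    using real_arch_simple by blast
  \<comment> \<open>A common shift moves all four parameters into the region already treated; they are then shifted back one at a time, which keeps the sum of the real parts above $-1$.\<close>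
  have nonneg: "Re (t + of_nat n) \<ge> 0" if "norm t \<le> real n" for t
    using abs_Re_le_cmod[of t] that by simp
  have "norm a \<le> real n" "norm b \<le> real n" "norm c \<le> real n" "norm d \<le> real n"
    using n norm_ge_zero[of a] norm_ge_zero[of b] norm_ge_zero[of c] norm_ge_zero[of d] by linarith+
  then have "wilson_formula (a + of_nat n) (b + of_nat n) (c + of_nat n) (d + of_nat n)"
    by (intro wilson_formula_nonneg nonneg)
  note descend = wilson_formula_descend_nat[rotated]
  have "wilson_formula a (b + of_nat n) (c + of_nat n) (d + of_nat n)"
    by (rule descend, fact) (use assms in simp)
  then have "wilson_formula (b + of_nat n) a (c + of_nat n) (d + of_nat n)"
    by (rule wilson_formula_swap12)
  then have "wilson_formula b a (c + of_nat n) (d + of_nat n)"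
    by (rule descend) (use assms in simp)
  then have "wilson_formula (c + of_nat n) b a (d + of_nat n)"
    by (rule wilson_formula_swap13[OF wilson_formula_swap12])
  then have "wilson_formula c b a (d + of_nat n)"
    by (rule descend) (use assms in simp)
  then have "wilson_formula (d + of_nat n) b c a"
    by (rule wilson_formula_swap14[OF wilson_formula_swap13])
  then have "wilson_formula d b c a"
    by (rule descend) (use assms in simp)
  then show ?thesis
    by (rule wilson_formula_swap14)
qed

theorem theorem4p6:
  fixes a b c d :: complex
  assumes "a \<noteq> 0" and "b \<noteq> 0" and "c \<noteq> 0" and "d \<noteq> 0"
    and "Re (a + b + c + d) > -1"
  shows "has_bochner_integral lborel
    (\<lambda>x::real. rGamma (2 * complex_of_real x) * rGamma (- 2 * complex_of_real x) *
       (\<Prod>t\<in>#{#a, b, c, d#}.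
          rGamma (1 + t + complex_of_real x) * rGamma (1 + t - complex_of_real x)))
    (- (1 / (2 * complex_of_real pi ^ 2)) *
       (Gamma (a + b + c + d + 1) *
          (rGamma (a + b + 1) * rGamma (a + c + 1) * rGamma (a + d + 1) *
           rGamma (b + c + 1) * rGamma (b + d + 1) * rGamma (c + d + 1))))"
proof -
  have "has_bochner_integral lborel (wilson_integrand a b c d) (wilson_integral a b c d)"
    unfolding wilson_integral_def
    by (intro has_bochner_integral_integrable integrable_wilson_integrand assms)
  moreover have "wilson_integrand a b c d = (\<lambda>x. rGamma (2 * complex_of_real x) * rGamma (- 2 * complex_of_real x) *
       (\<Prod>t\<in>#{#a, b, c, d#}.
          rGamma (1 + t + complex_of_real x) * rGamma (1 + t - complex_of_real x)))"
    by (simp add: fun_eq_iff wilson_integrand_def wilson_weight_def rGamma_quad_def rGamma_pair_def mult_ac)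
  ultimately show ?thesis
    using wilson_formula_all[OF assms(5)] by (simp only: wilson_formula_def wilson_value_def)
qed

end
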